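(* If the complete retained state is identifiable from $r$ observations at each permanent vertex of $S$ (i.e. $B_S$ has full column rank $K$, so that $\alpha\in\mathbb{R}^K$ is determined by $B_S\alpha$), then $$|S|\ \ge\ \max\left\{\left\lceil\frac{K}{r}\right\rceil,\ \mu_{\max}\right\}.$$
   Context: Let $G=(V,E,\omega)$ be a finite, undirected, connected graph with $n=|V|$ vertices and edge weights $\omega_{uv}>0$ for $\{u,v\}\in E$. Let $W$ be the weighted adjacency matrix ($W_{uv}=\omega_{uv}$ if $\{u,v\}\in E$, and $0$ otherwise), $D$ the diagonal matrix of weighted degrees $D_{vv}=\sum_u W_{uv}$, and $L=D-W$ the unnormalized weighted Laplacian. Fix an orthogonal eigendecomposition $L=U\Lambda U^T$, with orthonormal eigenvector columns $\phi_0,\ldots,\phi_{n-1}$ of $U$ and eigenvalues $0=\lambda_0<\lambda_1\le\cdots\le\lambda_{n-1}$; $\phi_\ell(v)$ is the entry of $\phi_\ell$ at vertex $v$. Fix a retained bandwidth $K$ with $1\le K\le n$. Retained states are $x_0=\sum_{\ell=0}^{K-1}\alpha_\ell\phi_\ell$, $\alpha\in\mathbb{R}^K$, evolving by $x(t)=e^{-tL}x_0$. Fix a prediction horizon $\tau>0$ and observation times $0\le t_1<\cdots<t_r<\tau$, so $r$ is the number of observations per location. For a vertex $v$, the measurement block is the matrix $R_v\in\mathbb{R}^{r\times K}$ with entries $R_v(j,\ell)=e^{-t_j\lambda_\ell}\phi_\ell(v)$, $j=1,\ldots,r$, $\ell=0,\ldots,K-1$. For a set of vertices $S=\{v_1,\ldots,v_m\}\subseteq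 V$ (permanent locations), $B_S\in\mathbb{R}^{rm\times K}$ is the matrix obtained by stacking $R_{v_1},\ldots,R_{v_m}$ vertically; the noiseless measurements are $B_S\alpha$. For each retained eigenvalue $\lambda$, let $\mu_K(\lambda)$ be its multiplicity among $\lambda_0,\ldots,\lambda_{K-1}$, and set $\mu_{\max}:=\max_\lambda\mu_K(\lambda)$. *)

theory Defs
  imports Complex_Main "Jordan_Normal_Form.DL_Rank"
begin

(* Edges are two-element sets, so there are neither loops nor parallel edges.  Only the values of
   w on E are relevant. *)
definition connected_weighted_graph :: "'v set \<Rightarrow> 'v set set \<Rightarrow> ('v set \<Rightarrow> real) \<Rightarrow> bool" where
  "connected_weighted_graph V E w \<longleftrightarrow>
     finite V \<and> V \<noteq> {} \<and>
     E \<subseteq> {{u, v} | u v. u \<in> V \<and> v \<in> V \<and> u \<noteq> v} \<and>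
     (\<forall>e\<in>E. w e > 0) \<and>
     (\<forall>u\<in>V. \<forall>v\<in>V. (u, v) \<in> {(x, y). {x, y} \<in> E}\<^sup>*)"

(* Matrices have rows and columns numbered from 0, so the vertex-indexed matrices below refer to
   an arbitrary numbering vx 0, ..., vx (n - 1) of the n vertices. *)

definition adjacency_matrix ::
  "nat \<Rightarrow> (nat \<Rightarrow> 'v) \<Rightarrow> 'v set set \<Rightarrow> ('v set \<Rightarrow> real) \<Rightarrow> real mat" where
  "adjacency_matrix n vx E w =
     mat n n (\<lambda>(i, j). if {vx i, vx j} \<in> E then w {vx i, vx j} else 0)"

definition degree_matrix ::
  "nat \<Rightarrow> (nat \<Rightarrow> 'v) \<Rightarrow> 'v set set \<Rightarrow> ('v set \<Rightarrow> real) \<Rightarrow> real mat" where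
  "degree_matrix n vx E w = mat_diag n (\<lambda>j. \<Sum>i<n. adjacency_matrix n vx E w $$ (i, j))"

definition laplacian ::
  "nat \<Rightarrow> (nat \<Rightarrow> 'v) \<Rightarrow> 'v set set \<Rightarrow> ('v set \<Rightarrow> real) \<Rightarrow> real mat" where
  "laplacian n vx E w = degree_matrix n vx E w - adjacency_matrix n vx E w"

(* The eigenvalues are lam 0, ..., lam (n - 1); for n = 1 the chain 0 = lam 0 < lam 1 <= ...
   reduces to 0 = lam 0. *)
definition ordered_eigendecomposition ::
  "nat \<Rightarrow> real mat \<Rightarrow> real mat \<Rightarrow> (nat \<Rightarrow> real) \<Rightarrow> bool" where
  "ordered_eigendecomposition n L U lam \<longleftrightarrow>
     U \<in> carrier_mat n n \<and> transpose_mat U * U = 1\<^sub>m n \<and>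
     L = U * mat_diag n lam * transpose_mat U \<and>
     lam 0 = 0 \<and> (1 < n \<longrightarrow> 0 < lam 1) \<and> (\<forall>i j. i \<le> j \<longrightarrow> j < n \<longrightarrow> lam i \<le> lam j)"

(* The entry of the l-th column of U at the vertex v. *)
definition eigvec_at :: "nat \<Rightarrow> (nat \<Rightarrow> 'v) \<Rightarrow> real mat \<Rightarrow> nat \<Rightarrow> 'v \<Rightarrow> real" where
  "eigvec_at n vx U l v = U $$ (inv_into {..<n} vx v, l)"

(* The observation times t_1 < ... < t_r are ts ! 0 < ... < ts ! (r - 1), with r = length ts. *)
definition measurement_block ::
  "nat \<Rightarrow> (nat \<Rightarrow> 'v) \<Rightarrow> real mat \<Rightarrow> (nat \<Rightarrow> real) \<Rightarrow> real list \<Rightarrow> nat \<Rightarrow> 'v \<Rightarrow> real mat" where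
  "measurement_block n vx U lam ts K v =
     mat (length ts) K (\<lambda>(j, l). exp (- (ts ! j) * lam l) * eigvec_at n vx U l v)"

(* The locations come as a list, which fixes the order in which their blocks are stacked. *)
definition measurement_matrix ::
  "nat \<Rightarrow> (nat \<Rightarrow> 'v) \<Rightarrow> real mat \<Rightarrow> (nat \<Rightarrow> real) \<Rightarrow> real list \<Rightarrow> nat \<Rightarrow> 'v list \<Rightarrow> real mat" where
  "measurement_matrix n vx U lam ts K vs =
     mat_of_rows K (concat (map (\<lambda>v. rows (measurement_block n vx U lam ts K v)) vs))"

definition retained_mult :: "(nat \<Rightarrow> real) \<Rightarrow> nat \<Rightarrow> real \<Rightarrow> nat" where
  "retained_mult lam K x = card {l. l < K \<and> lam l = x}"

definition max_retained_mult :: "(nat \<Rightarrow> real) \<Rightarrow> nat \<Rightarrow> nat" where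
  "max_retained_mult lam K = Max (retained_mult lam K ` lam ` {..<K})"

end

theory Submission
  imports Defs
begin

text \<open>
  Full column rank means that \<open>B\<^sub>S \<alpha> = 0\<close> forces \<open>\<alpha> = 0\<close>, so each bound follows by exhibiting too few
  linear conditions. The system \<open>B\<^sub>S \<alpha> = 0\<close> has \<open>r |S|\<close> equations in \<open>K\<close> unknowns, hence \<open>K \<le> r |S|\<close>.
  If \<open>\<alpha>\<close> is supported on the indices of a single eigenvalue \<open>x\<close>, the time factor \<open>e\<^sup>-\<^sup>t\<^sup>x\<close> comes out of
  every measurement at \<open>v\<close>, so that \<open>B\<^sub>S \<alpha> = 0\<close> reduces to one equation per vertex of \<open>S\<close>; hence the
  multiplicity of \<open>x\<close> is at most \<open>|S|\<close>.
\<close>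

text \<open>Padding the \<open>m\<close> equations with zero rows gives a singular square matrix,
  whose kernel supplies \<open>c\<close>. The index set \<open>J\<close> is arbitrary so that the
  unknowns can be all columns or only those of one eigenvalue.\<close>

lemma underdetermined_system_nontrivial:
  fixes f :: "nat \<Rightarrow> 'j \<Rightarrow> 'a :: field"
  assumes "finite J" and "m < card J"
  obtains c where "\<exists>j\<in>J. c j \<noteq> 0" and "\<And>i. i < m \<Longrightarrow> (\<Sum>j\<in>J. f i j * c j) = 0"
proof -
  let ?k = "card J"
  obtain h where h: "bij_betw h {..<?k} J"
    using ex_bij_betw_nat_finite[OF assms(1)] by (auto simp: atLeast0LessThan)
  define A where "A = mat ?k ?k (\<lambda>(i, j). if i < m then f i (h j) else 0)"
  have A: "A \<in> carrier_mat ?k ?k" by (simp add: A_def)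
  \<comment> \<open>The left side is the last row of \<open>A\<close>, a padding row because
    \<open>m < ?k\<close>.\<close>
  have "A\<^sup>T *\<^sub>v unit_vec ?k (?k - 1) = 0\<^sub>v ?k"
    using assms(2) by (intro eq_vecI) (auto simp: A_def)
  moreover have "unit_vec ?k (?k - 1) \<noteq> (0\<^sub>v ?k :: 'a vec)"
  proof
    assume "unit_vec ?k (?k - 1) = (0\<^sub>v ?k :: 'a vec)"
    then have "unit_vec ?k (?k - 1) $ (?k - 1) = (0\<^sub>v ?k :: 'a vec) $ (?k - 1)" by simp
    then show False using assms(2) by simp
  qed
  ultimately have "det A\<^sup>T = 0"
    using A by (subst det_0_iff_vec_prod_zero_field[of _ ?k]) (auto intro!: exI[of _ "unit_vec ?k (?k - 1)"])
  then have "det A = 0" using det_transpose[OF A] by simp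
  then obtain v where v: "v \<in> carrier_vec ?k" "v \<noteq> 0\<^sub>v ?k" "A *\<^sub>v v = 0\<^sub>v ?k"
    using det_0_iff_vec_prod_zero_field[OF A] by blast
  define c where "c = (\<lambda>j. v $ inv_into {..<?k} h j)"
  have ch: "c (h l) = v $ l" if "l < ?k" for l
    using that h by (simp add: c_def bij_betw_inv_into_left)
  show thesis
  proof
    obtain l where "l < ?k" "v $ l \<noteq> 0"
      using v(1,2) by (metis carrier_vecD eq_vecI index_zero_vec)
    then show "\<exists>j\<in>J. c j \<noteq> 0"
      using ch[of l] h by (auto simp: bij_betw_def intro!: bexI[of _ "h l"])
  next
    fix i assume i: "i < m"
    then have ik: "i < ?k" using assms(2) by simp
    have "(\<Sum>j\<in>J. f i j * c j) = (\<Sum>l<?k. f i (h l) * c (h l))"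
      by (rule sum.reindex_bij_betw[OF h, symmetric])
    also have "\<dots> = (A *\<^sub>v v) $ i"
      using ik i v(1) by (simp add: A_def scalar_prod_def ch atLeast0LessThan)
    also have "\<dots> = 0" using v(3) ik by simp
    finally show "(\<Sum>j\<in>J. f i j * c j) = 0" .
  qed
qed

context vec_space
begin

text \<open>The rank is the size of a maximal independent subset of the set of columns. A repeated
  column would leave fewer than \<open>nc\<close> elements in that set.\<close>

lemma full_rank_distinct_cols:
  assumes "A \<in> carrier_mat n nc" and "rank A = nc"
  shows "distinct (cols A)"
proof -
  obtain T where T: "maximal T (\<lambda>T. T \<subseteq> set (cols A) \<and> lin_indpt T)"
    using maximal_exists_superset[of "set (cols A)" "\<lambda>T. T \<subseteq> set (cols A) \<and> lin_indpt T" "{}"]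
    by (auto simp: lin_dep_def)
  then have "card T \<le> card (set (cols A))"
    by (simp add: card_mono maximal_def)
  then have "length (cols A) \<le> card (set (cols A))"
    using rank_card_indpt[OF assms(1) T] assms by simp
  then show ?thesis
    using card_length[of "cols A"] by (intro card_distinct) linarith
qed

text \<open>A nonzero kernel vector is a linear dependence among the columns. Distinctness lets its
  entries serve as coefficients on the set of columns, which full rank makes independent.\<close>

lemma full_rank_kernel_trivial:
  assumes "A \<in> carrier_mat n nc" and "rank A = nc"
    and "v \<in> carrier_vec nc" and "A *\<^sub>v v = 0\<^sub>v n"
  shows "v = 0\<^sub>v nc"
  using assms lin_depI full_rank_lin_indpt full_rank_distinct_cols by blast

end

lemma measurement_matrix_carrier:
  "measurement_matrix n vx U lam ts K vs \<in> carrier_mat (length ts * length vs) K"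
proof -
  have "length (concat (map (\<lambda>v. rows (measurement_block n vx U lam ts K v)) vs)) = length ts * length vs"
    by (induction vs) (simp_all add: measurement_block_def)
  then show ?thesis
    unfolding measurement_matrix_def by (metis mat_of_rows_carrier(1))
qed

lemma measurement_matrix_mult_zeroI:
  assumes "\<And>v j. v \<in> set vs \<Longrightarrow> j < length ts \<Longrightarrow>
    (\<Sum>l<K. exp (- (ts ! j) * lam l) * eigvec_at n vx U l v * c l) = 0"
  shows "measurement_matrix n vx U lam ts K vs *\<^sub>v vec K c = 0\<^sub>v (length ts * length vs)"
proof (rule eq_vecI)
  let ?B = "measurement_matrix n vx U lam ts K vs"
  let ?rs = "concat (map (\<lambda>v. rows (measurement_block n vx U lam ts K v)) vs)"
  fix i assume "i < dim_vec (0\<^sub>v (length ts * length vs) :: real vec)"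
  then have i: "i < dim_row ?B" using measurement_matrix_carrier[of n vx U lam ts K vs] by simp
  then have i': "i < length ?rs" by (simp add: measurement_matrix_def)
  \<comment> \<open>Membership in the concatenation already yields a location \<open>v\<close> and a
    time index \<open>j\<close> for row \<open>i\<close>, so no arithmetic on block offsets is
    needed.\<close>
  then have "?rs ! i \<in> set ?rs" by (rule nth_mem)
  then obtain v where v: "v \<in> set vs" and "?rs ! i \<in> set (rows (measurement_block n vx U lam ts K v))"
    by auto
  then obtain j where j: "j < length ts" "?rs ! i = row (measurement_block n vx U lam ts K v) j"
    by (auto simp: rows_def measurement_block_def)
  have "row ?B i = row (measurement_block n vx U lam ts K v) j"
    using i' j unfolding measurement_matrix_def
    by (subst mat_of_rows_row) (auto simp: measurement_block_def)
  then have "(?B *\<^sub>v vec K c) $ i = row (measurement_block n vx U lam ts K v) j \<bullet> vec K c"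
    using i by simp
  also have "\<dots> = (\<Sum>l<K. exp (- (ts ! j) * lam l) * eigvec_at n vx U l v * c l)"
    using j(1) by (simp add: measurement_block_def scalar_prod_def atLeast0LessThan)
  also have "\<dots> = 0" using assms v j(1) by simp
  finally show "(?B *\<^sub>v vec K c) $ i = 0\<^sub>v (length ts * length vs) $ i"
    using i measurement_matrix_carrier[of n vx U lam ts K vs] by simp
qed (use measurement_matrix_carrier[of n vx U lam ts K vs] in simp)

text \<open>With more columns than rows, the homogeneous system has a nontrivial solution,
  contradicting the trivial kernel.\<close>

lemma full_rank_bound:
  fixes A :: "'a :: field mat"
  assumes A: "A \<in> carrier_mat nr nc" and "vec_space.rank nr A = nc"
  shows "nc \<le> nr"
proof (rule ccontr)
  assume "\<not> nc \<le> nr"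
  then obtain c where c: "\<exists>l\<in>{..<nc}. c l \<noteq> 0" "\<And>i. i < nr \<Longrightarrow> (\<Sum>l<nc. A $$ (i, l) * c l) = 0"
    using underdetermined_system_nontrivial[of "{..<nc}" nr "\<lambda>i l. A $$ (i, l)"] by auto
  have "A *\<^sub>v vec nc c = 0\<^sub>v nr"
    using A c(2) by (intro eq_vecI) (auto simp: scalar_prod_def atLeast0LessThan)
  then have "vec nc c = 0\<^sub>v nc"
    using vec_space.full_rank_kernel_trivial[OF assms] by simp
  then show False using c(1) by (metis index_vec index_zero_vec(1) lessThan_iff)
qed

lemma retained_mult_le_locations:
  assumes rank: "vec_space.rank (length ts * length vs) (measurement_matrix n vx U lam ts K vs) = K"
  shows "retained_mult lam K x \<le> length vs"
proof (rule ccontr)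
  let ?J = "{l. l < K \<and> lam l = x}"
  assume "\<not> retained_mult lam K x \<le> length vs"
  then have "length vs < card ?J" by (simp add: retained_mult_def)
  then obtain c where c: "\<exists>l\<in>?J. c l \<noteq> 0"
      "\<And>i. i < length vs \<Longrightarrow> (\<Sum>l\<in>?J. eigvec_at n vx U l (vs ! i) * c l) = 0"
    using underdetermined_system_nontrivial[of ?J "length vs" "\<lambda>i l. eigvec_at n vx U l (vs ! i)"]
    by auto
  \<comment> \<open>The values of \<open>c\<close> outside \<open>?J\<close> are arbitrary, so they
    are cut off to obtain a state in a single eigenspace.\<close>
  define d where "d l = (if lam l = x then c l else 0)" for l
  have "measurement_matrix n vx U lam ts K vs *\<^sub>v vec K d = 0\<^sub>v (length ts * length vs)"
  proof (rule measurement_matrix_mult_zeroI)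
    fix v j assume "v \<in> set vs"
    then obtain i where i: "i < length vs" "v = vs ! i" by (auto simp: in_set_conv_nth)
    have "(\<Sum>l<K. exp (- (ts ! j) * lam l) * eigvec_at n vx U l v * d l)
        = (\<Sum>l\<in>?J. exp (- (ts ! j) * x) * (eigvec_at n vx U l v * c l))"
      by (rule sum.mono_neutral_cong_right) (auto simp: d_def)
    \<comment> \<open>The remaining sum does not involve \<open>j\<close>: one equation at
      \<open>v\<close> settles all observation times.\<close>
    also have "\<dots> = exp (- (ts ! j) * x) * (\<Sum>l\<in>?J. eigvec_at n vx U l v * c l)"
      by (simp add: sum_distrib_left)
    also have "\<dots> = 0" using c(2) i by simp
    finally show "(\<Sum>l<K. exp (- (ts ! j) * lam l) * eigvec_at n vx U l v * d l) = 0" .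
  qed
  then have "vec K d = 0\<^sub>v K"
    using vec_space.full_rank_kernel_trivial[OF measurement_matrix_carrier rank] by simp
  moreover obtain l where "l < K" "lam l = x" "c l \<noteq> 0" using c(1) by auto
  ultimately show False by (metis d_def index_vec index_zero_vec(1))
qed

theorem proposition2p2:
  fixes V :: "'v set" and E :: "'v set set" and w :: "'v set \<Rightarrow> real"
    and n K r :: nat and vx :: "nat \<Rightarrow> 'v"
    and U :: "real mat" and lam :: "nat \<Rightarrow> real"
    and \<tau> :: real and ts :: "real list"
    and S :: "'v set" and vs :: "'v list"
  assumes "connected_weighted_graph V E w"
    and "n = card V" and "bij_betw vx {..<n} V"
    and "ordered_eigendecomposition n (laplacian n vx E w) U lam"
    and "1 \<le> K" and "K \<le> n"
    and "\<tau> > 0"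
    and "length ts = r" and "1 \<le> r"
    and "sorted_wrt (<) ts" and "\<forall>t\<in>set ts. 0 \<le> t \<and> t < \<tau>"
    and "S \<subseteq> V" and "distinct vs" and "set vs = S"
    and "vec_space.rank (r * card S) (measurement_matrix n vx U lam ts K vs) = K"
  shows "int (card S) \<ge> max \<lceil>real K / real r\<rceil> (int (max_retained_mult lam K))"
proof -
  have len: "length vs = card S"
    using assms(13,14) distinct_card by fastforce
  \<comment> \<open>The rank depends on the declared row dimension, which is rewritten here to the
    form used for the stacked matrix.\<close>
  note rank = assms(15)[folded \<open>length ts = r\<close> len]
  have "K \<le> r * card S"
    using full_rank_bound[OF measurement_matrix_carrier rank] assms(8) len by simp
  then have "real K \<le> real (card S) * real r"
    by (metis mult.commute of_nat_le_iff of_nat_mult)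
  then have "\<lceil>real K / real r\<rceil> \<le> int (card S)"
    using \<open>1 \<le> r\<close> by (simp add: ceiling_le_iff divide_le_eq)
  moreover have "max_retained_mult lam K \<le> card S"
    unfolding max_retained_mult_def
  proof (rule Max.boundedI)
    show "retained_mult lam K ` lam ` {..<K} \<noteq> {}" using \<open>1 \<le> K\<close> by (auto simp: lessThan_empty_iff)
  qed (use retained_mult_le_locations[OF rank] len in auto)
  ultimately show ?thesis by simp
qed

end
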